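(* Every digraph $G$ with $n$ vertices and minimum outdegree at least $22$ has a stable set with at least $\frac{n}{3}$ vertices.
   Context: Digraphs are finite, with no loops and no parallel arcs (a pair of oppositely directed arcs $uv$ and $vu$ is allowed). A set $T$ of vertices in a digraph $G$ is a stable set if for each vertex $v\in T$, at most half the out-neighbours of $v$ (in $G$) are also in $T$. (This is not the usual notion of an independent set.) *)

theory Defs
  imports Complex_Main "Graph_Theory.Digraph"
begin

definition out_neighbours :: "('a, 'b) pre_digraph \<Rightarrow> 'a \<Rightarrow> 'a set" where
  "out_neighbours G v = {w. v \<rightarrow>\<^bsub>G\<^esub> w}"

text \<open>
  This is not the usual notion of an independent set: arcs inside \<open>T\<close> are allowed, as long as
  for each \<open>v \<in> T\<close> at most half of the out-neighbours of \<open>v\<close> in the whole digraph lie in \<open>T\<close>.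
\<close>
definition stable_set :: "('a, 'b) pre_digraph \<Rightarrow> 'a set \<Rightarrow> bool" where
  "stable_set G T \<longleftrightarrow> T \<subseteq> verts G \<and>
     (\<forall>v\<in>T. real (card (out_neighbours G v \<inter> T)) \<le> real (card (out_neighbours G v)) / 2)"

end

theory Submission
  imports Defs
begin

text \<open>
  Put every vertex independently into a random set \<open>A\<close> with probability \<open>2/5\<close> and discard from
  \<open>A\<close> the vertices having more than half of their out-neighbours in \<open>A\<close>; discarding vertices
  cannot destroy the condition at the others, so the remaining set is stable. As there are no
  loops, a vertex of outdegree \<open>d\<close> survives with probability \<open>2/5 \<cdot> P(Bin(d, 2/5) \<le> d/2)\<close>. For
  odd \<open>d = 2k + 1\<close> the binomial tail increases with \<open>k\<close>, for even \<open>d = 2k\<close> it is larger still, and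
  for \<open>d = 23\<close> the product exceeds \<open>1/3\<close>. Hence the expected size of the stable set is at
  least \<open>n/3\<close>.
\<close>

section \<open>Binomial tails\<close>

definition binomial_mass :: "real \<Rightarrow> nat \<Rightarrow> nat \<Rightarrow> real" where
  "binomial_mass p n k = real (n choose k) * p ^ k * (1 - p) ^ (n - k)"

definition binomial_tail :: "real \<Rightarrow> nat \<Rightarrow> nat \<Rightarrow> real" where
  "binomial_tail p n k = (\<Sum>j\<le>k. binomial_mass p n j)"

lemma binomial_mass_nonneg: "0 \<le> p \<Longrightarrow> p \<le> 1 \<Longrightarrow> 0 \<le> binomial_mass p n k"
  by (simp add: binomial_mass_def)

lemma binomial_mass_Suc_Suc:
  "binomial_mass p (Suc n) (Suc k) =
    p * binomial_mass p n k + (1 - p) * binomial_mass p n (Suc k)"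
proof (cases "k < n")
  case True
  then have "n - k = Suc (n - Suc k)" by simp
  then show ?thesis by (simp add: binomial_mass_def algebra_simps)
next
  case False
  then show ?thesis by (simp add: binomial_mass_def binomial_eq_0)
qed

text \<open>With the threshold fixed, one more trial spoils the event only if the first
  \<open>n\<close> trials give exactly \<open>k\<close> successes and the new trial
  succeeds.\<close>

lemma binomial_tail_Suc:
  "binomial_tail p (Suc n) k = binomial_tail p n k - p * binomial_mass p n k"
proof (induction k)
  case 0
  then show ?case by (simp add: binomial_tail_def binomial_mass_def algebra_simps)
next
  case (Suc k)
  then show ?case
    by (simp add: binomial_tail_def binomial_mass_Suc_Suc algebra_simps)
qed

text \<open>Add two trials and raise the threshold by one. The event is gained when exactly
  \<open>k + 1\<close> successes are followed by two failures, and lost when exactly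
  \<open>k\<close> are followed by two successes. For \<open>p\<close> \<le> 1/2 the gain is at
  least the loss.\<close>

lemma binomial_tail_odd_mono:
  assumes "0 \<le> p" "p \<le> 1 / 2" "m \<le> k"
  shows "binomial_tail p (2 * m + 1) m \<le> binomial_tail p (2 * k + 1) k"
proof -
  have step: "binomial_tail p (2 * k + 1) k \<le> binomial_tail p (2 * Suc k + 1) (Suc k)" for k
  proof -
    \<comment> \<open>By the symmetry of the middle binomial coefficients, the gain is
      \<open>(1 - p) * ?c\<close> and the loss is \<open>p * ?c\<close>.\<close>
    let ?n = "2 * k + 1" and ?c = "real ((2 * k + 1) choose k) * p ^ Suc k * (1 - p) ^ Suc k"
    have "(2 * k + 1) choose Suc k = (2 * k + 1) choose k"
      using binomial_symmetric[of k "2 * k + 1"] by simp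
    then have "(1 - p)\<^sup>2 * binomial_mass p ?n (Suc k) = (1 - p) * ?c"
      by (simp add: binomial_mass_def power2_eq_square)
    moreover have "p\<^sup>2 * binomial_mass p ?n k = p * ?c"
      by (simp add: binomial_mass_def power2_eq_square Suc_diff_le)
    moreover have "binomial_tail p (2 * Suc k + 1) (Suc k) = binomial_tail p ?n k
        + (1 - p)\<^sup>2 * binomial_mass p ?n (Suc k) - p\<^sup>2 * binomial_mass p ?n k"
    proof -
      have "binomial_tail p (Suc (Suc ?n)) (Suc k) = binomial_tail p ?n (Suc k)
          - p * binomial_mass p ?n (Suc k) - p * binomial_mass p (Suc ?n) (Suc k)"
        by (simp only: binomial_tail_Suc)
      moreover have "binomial_tail p ?n (Suc k) =
          binomial_tail p ?n k + binomial_mass p ?n (Suc k)"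
        by (simp add: binomial_tail_def)
      moreover have "Suc (Suc ?n) = 2 * Suc k + 1" by simp
      ultimately show ?thesis
        unfolding binomial_mass_Suc_Suc by (simp add: power2_eq_square algebra_simps)
    qed
    moreover have "p * ?c \<le> (1 - p) * ?c"
      using assms by (intro mult_right_mono) auto
    ultimately show ?thesis by linarith
  qed
  show ?thesis
    by (rule lift_Suc_mono_le[of "\<lambda>k. binomial_tail p (2 * k + 1) k", OF step \<open>m \<le> k\<close>])
qed

lemma binomial_tail_half:
  assumes "22 \<le> d"
  shows "1 / 3 \<le> 2 / 5 * binomial_tail (2 / 5) d (d div 2)"
proof -
  define k where "k = d div 2"
  \<comment> \<open>5/6 is 1/3 divided by 2/5. As \<open>d\<close> \<ge> 22 forces \<open>k\<close>
    \<ge> 11, the smallest odd case \<open>2 * k + 1\<close> is 23, which is evaluated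
    numerically.\<close>
  have "5 / 6 \<le> binomial_tail (2 / 5) 23 11"
  proof -
    have "{..11::nat} = {0, 1, 2, 3, 4, 5, 6, 7, 8, 9, 10, 11}"
      by (auto; presburger)
    then show ?thesis
      by (simp add: binomial_tail_def binomial_mass_def binomial_fact fact_numeral power_divide)
  qed
  also have "\<dots> \<le> binomial_tail (2 / 5) (2 * k + 1) k"
    using binomial_tail_odd_mono[of "2 / 5" 11 k] assms by (simp add: k_def)
  also have "\<dots> \<le> binomial_tail (2 / 5) d k"
  proof (cases "even d")
    case True
    \<comment> \<open>Here the odd case has one trial more with the same threshold, so its tail is
      no larger.\<close>
    then have "2 * k + 1 = Suc d" by (simp add: k_def)
    then show ?thesis
      using binomial_mass_nonneg[of "2 / 5" d k] by (simp add: binomial_tail_Suc)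
  next
    case False
    then have "2 * k + 1 = d" by (simp add: k_def)
    then show ?thesis by simp
  qed
  finally show ?thesis by (simp add: k_def)
qed

section \<open>Random subsets\<close>

text \<open>The expectation of \<open>f A\<close> when \<open>A\<close> contains each element of \<open>S\<close> independently with
  probability \<open>p\<close>.\<close>
definition subset_mean :: "real \<Rightarrow> 'a set \<Rightarrow> ('a set \<Rightarrow> real) \<Rightarrow> real" where
  "subset_mean p S f = (\<Sum>A\<in>Pow S. p ^ card A * (1 - p) ^ card (S - A) * f A)"

lemma subset_mean_cong:
  "(\<And>A. A \<subseteq> S \<Longrightarrow> f A = g A) \<Longrightarrow> subset_mean p S f = subset_mean p S g"
  by (simp add: subset_mean_def)

text \<open>Conditioning on whether \<open>v\<close> is chosen; this recursion drives the inductions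
  below.\<close>

lemma subset_mean_insert:
  assumes "finite S" "v \<notin> S"
  shows "subset_mean p (insert v S) f =
    p * subset_mean p S (\<lambda>A. f (insert v A)) + (1 - p) * subset_mean p S f"
proof -
  let ?w = "\<lambda>A. p ^ card A * (1 - p) ^ card (insert v S - A) * f A"
  have inj: "inj_on (insert v) (Pow S)"
    using assms by (auto intro!: inj_onI simp: insert_ident subset_eq)
  have "subset_mean p (insert v S) f = sum ?w (Pow S) + sum ?w (insert v ` Pow S)"
    unfolding subset_mean_def Pow_insert
    using assms by (intro sum.union_disjoint) auto
  also have "sum ?w (Pow S) = (1 - p) * subset_mean p S f"
    unfolding subset_mean_def sum_distrib_left
  proof (rule sum.cong)
    fix A assume "A \<in> Pow S"
    then have "insert v S - A = insert v (S - A)" "v \<notin> S - A" "finite (S - A)"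
      using assms by auto
    then show "?w A = (1 - p) * (p ^ card A * (1 - p) ^ card (S - A) * f A)" by simp
  qed simp
  also have "sum ?w (insert v ` Pow S) = p * subset_mean p S (\<lambda>A. f (insert v A))"
    unfolding subset_mean_def sum_distrib_left sum.reindex[OF inj] comp_def
  proof (rule sum.cong)
    fix A assume "A \<in> Pow S"
    then have "insert v S - insert v A = S - A" "v \<notin> A" "finite A"
      using assms by (auto intro: finite_subset)
    then show "?w (insert v A) = p * (p ^ card A * (1 - p) ^ card (S - A) * f (insert v A))"
      by simp
  qed simp
  finally show ?thesis by simp
qed

text \<open>Marginalisation: each element outside \<open>N\<close> leaves the value of
  \<open>f\<close> unchanged, and its two weights \<open>p\<close> and \<open>1 - p\<close> add up
  to 1.\<close>

lemma subset_mean_restrict: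
  assumes "finite S" "N \<subseteq> S"
  shows "subset_mean p S (\<lambda>A. f (A \<inter> N)) = subset_mean p N f"
proof -
  have "subset_mean p (M \<union> N) (\<lambda>A. f (A \<inter> N)) = subset_mean p N f"
    if "finite M" "M \<inter> N = {}" for M
    using that
  proof (induction M)
    case empty
    have "subset_mean p N (\<lambda>A. f (A \<inter> N)) = subset_mean p N f"
      by (rule subset_mean_cong) (simp add: Int_absorb2)
    then show ?case by simp
  next
    case (insert v M)
    have "finite (M \<union> N)" "v \<notin> M \<union> N" "v \<notin> N"
      using insert assms finite_subset by auto
    then show ?case
      using insert by (simp add: subset_mean_insert algebra_simps)
  qed
  from this[of "S - N"] show ?thesis
    using assms by (simp add: Un_absorb2 Int_commute)
qed

text \<open>Grouping subsets by size shows that the size of the random subset is binomially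
  distributed.\<close>

lemma subset_mean_card:
  assumes "finite S"
  shows "subset_mean p S (\<lambda>A. g (card A)) = (\<Sum>k\<le>card S. binomial_mass p (card S) k * g k)"
proof -
  let ?w = "\<lambda>A. p ^ card A * (1 - p) ^ card (S - A) * g (card A)"
  have "subset_mean p S (\<lambda>A. g (card A)) = (\<Sum>k\<le>card S. \<Sum>A | A \<in> Pow S \<and> card A = k. ?w A)"
    unfolding subset_mean_def
    using assms by (intro sum.group[symmetric]) (auto intro: card_mono)
  also have "\<dots> = (\<Sum>k\<le>card S. binomial_mass p (card S) k * g k)"
  proof (rule sum.cong)
    fix k
    have "?w A = p ^ k * (1 - p) ^ (card S - k) * g k" if "A \<subseteq> S" "card A = k" for A
      using that assms card_Diff_subset[of A S] finite_subset[of A S] by simp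
    then have "(\<Sum>A | A \<in> Pow S \<and> card A = k. ?w A) =
        (\<Sum>A | A \<subseteq> S \<and> card A = k. p ^ k * (1 - p) ^ (card S - k) * g k)"
      by (intro sum.cong) auto
    then show "(\<Sum>A | A \<in> Pow S \<and> card A = k. ?w A) = binomial_mass p (card S) k * g k"
      using assms by (simp add: n_subsets binomial_mass_def)
  qed simp
  finally show ?thesis .
qed

lemma subset_mean_sum:
  "subset_mean p S (\<lambda>A. \<Sum>i\<in>I. f i A) = (\<Sum>i\<in>I. subset_mean p S (f i))"
  unfolding subset_mean_def sum_distrib_left by (rule sum.swap)

lemma subset_mean_const: "finite S \<Longrightarrow> subset_mean p S (\<lambda>_. c) = c"
  by (induction S rule: finite_induct)
    (simp_all add: subset_mean_insert algebra_simps, simp add: subset_mean_def)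

text \<open>First-moment principle. Strict bounds on \<open>p\<close> make every weight positive, so
  if all values lay below the mean, the mean would lie below itself.\<close>

lemma ex_ge_subset_mean:
  assumes "finite S" "0 < p" "p < 1"
  shows "\<exists>A\<subseteq>S. subset_mean p S f \<le> f A"
proof (rule ccontr)
  assume *: "\<not> ?thesis"
  have "subset_mean p S f < subset_mean p S (\<lambda>_. subset_mean p S f)"
    unfolding subset_mean_def[of p S f] subset_mean_def[of p S "\<lambda>_. _"]
    using assms * by (intro sum_strict_mono) (auto simp: not_le subset_mean_def)
  then show False
    using assms by (simp add: subset_mean_const)
qed

lemma subset_mean_low_degree:
  assumes "finite S" "v \<in> S" "N \<subseteq> S" "v \<notin> N"
  shows "subset_mean p S (\<lambda>A. of_bool (v \<in> A \<and> 2 * card (N \<inter> A) \<le> card N)) =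
    p * binomial_tail p (card N) (card N div 2)"
proof -
  let ?f = "\<lambda>A. of_bool (v \<in> A \<and> 2 * card (N \<inter> A) \<le> card N) :: real"
  let ?g = "\<lambda>k. of_bool (2 * k \<le> card N) :: real"
  have fin: "finite N"
    using assms finite_subset by blast
  have "subset_mean p S ?f = subset_mean p S (\<lambda>A. ?f (A \<inter> insert v N))"
  proof (rule subset_mean_cong)
    fix A
    have "N \<inter> (A \<inter> insert v N) = N \<inter> A" by blast
    then show "?f A = ?f (A \<inter> insert v N)" by simp
  qed
  also have "\<dots> = subset_mean p (insert v N) ?f"
    using assms by (intro subset_mean_restrict) auto
  also have "\<dots> = p * subset_mean p N (\<lambda>A. ?f (insert v A)) + (1 - p) * subset_mean p N ?f"
    using fin assms by (intro subset_mean_insert)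
  also have "subset_mean p N ?f = subset_mean p N (\<lambda>_. 0)"
    using assms by (intro subset_mean_cong) auto
  also have "subset_mean p N (\<lambda>A. ?f (insert v A)) = subset_mean p N (\<lambda>A. ?g (card A))"
    using assms by (intro subset_mean_cong) (auto simp: Int_absorb1)
  also have "\<dots> = (\<Sum>k\<le>card N. binomial_mass p (card N) k * ?g k)"
    using fin by (rule subset_mean_card)
  also have "\<dots> = (\<Sum>k\<le>card N div 2. binomial_mass p (card N) k)"
    by (intro sum.mono_neutral_cong_right) auto
  finally show ?thesis
    using fin by (simp add: subset_mean_const binomial_tail_def)
qed

section \<open>Stable sets\<close>

lemma stable_set_low_degree:
  assumes "A \<subseteq> verts G" "\<And>v. v \<in> A \<Longrightarrow> finite (out_neighbours G v)"
  shows "stable_set G {v \<in> A. 2 * card (out_neighbours G v \<inter> A) \<le> card (out_neighbours G v)}"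
    (is "stable_set G ?T")
  unfolding stable_set_def
proof (intro conjI ballI)
  fix v assume v: "v \<in> ?T"
  have "card (out_neighbours G v \<inter> ?T) \<le> card (out_neighbours G v \<inter> A)"
    using v assms by (intro card_mono) auto
  then show "real (card (out_neighbours G v \<inter> ?T)) \<le> real (card (out_neighbours G v)) / 2"
    using v by auto
qed (use assms in auto)

text \<open>Outdegree counts arcs while stability counts vertices; the counts agree because the
  absence of parallel arcs makes \<open>head G\<close> injective on the arcs leaving
  \<open>v\<close>.\<close>

lemma (in digraph) card_out_neighbours: "card (out_neighbours G v) = out_degree G v"
proof -
  have "out_neighbours G v = head G ` out_arcs G v"
    by (auto simp: out_neighbours_def arcs_ends_conv arc_to_ends_def out_arcs_def image_iff)
  moreover have "inj_on (head G) (out_arcs G v)"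
    by (auto intro!: inj_onI no_multi_arcs simp: arc_to_ends_def)
  ultimately show ?thesis
    by (simp add: out_degree_def card_image)
qed

lemma (in digraph) out_neighbours_subset: "out_neighbours G v \<subseteq> verts G"
  by (auto simp: out_neighbours_def)

lemma (in digraph) not_in_out_neighbours: "v \<notin> out_neighbours G v"
  by (auto simp: out_neighbours_def dest: adj_not_same)

theorem theorem6:
  fixes G :: "('a, 'b) pre_digraph" and n :: nat
  assumes "digraph G"
    and "card (verts G) = n"
    and "\<forall>v\<in>verts G. out_degree G v \<ge> 22"
  shows "\<exists>T. stable_set G T \<and> real (card T) \<ge> real n / 3"
proof -
  interpret digraph G by fact
  \<comment> \<open>A vertex survives with probability at most \<open>p\<close>, so \<open>p\<close>
    must be at least 1/3; the monotonicity of the tails needs \<open>p\<close> \<le> 1/2.\<close>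
  define p :: real where "p = 2 / 5"
  let ?N = "out_neighbours G"
  let ?T = "\<lambda>A. {v \<in> A. 2 * card (?N v \<inter> A) \<le> card (?N v)}"
  let ?f = "\<lambda>v A. of_bool (v \<in> A \<and> 2 * card (?N v \<inter> A) \<le> card (?N v)) :: real"
  have "real n / 3 = (\<Sum>v\<in>verts G. 1 / 3)"
    using assms by simp
  also have "\<dots> \<le> (\<Sum>v\<in>verts G. subset_mean p (verts G) (?f v))"
  proof (rule sum_mono)
    fix v assume v: "v \<in> verts G"
    have "subset_mean p (verts G) (?f v) = p * binomial_tail p (card (?N v)) (card (?N v) div 2)"
      using v out_neighbours_subset not_in_out_neighbours by (intro subset_mean_low_degree) auto
    then show "1 / 3 \<le> subset_mean p (verts G) (?f v)"
      using binomial_tail_half[of "card (?N v)"] v assms by (simp add: p_def card_out_neighbours)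
  qed
  \<comment> \<open>Linearity of expectation turns the sum of survival probabilities into the
    expected size of \<open>?T A\<close>.\<close>
  also have "\<dots> = subset_mean p (verts G) (\<lambda>A. \<Sum>v\<in>verts G. ?f v A)"
    by (rule subset_mean_sum[symmetric])
  also have "\<dots> = subset_mean p (verts G) (\<lambda>A. real (card (?T A)))"
  proof (rule subset_mean_cong)
    fix A assume "A \<subseteq> verts G"
    then have "verts G \<inter> {v. v \<in> A \<and> 2 * card (?N v \<inter> A) \<le> card (?N v)} = ?T A" by auto
    then show "(\<Sum>v\<in>verts G. ?f v A) = real (card (?T A))" by simp
  qed
  finally have *: "real n / 3 \<le> subset_mean p (verts G) (\<lambda>A. real (card (?T A)))" .
  obtain A where A: "A \<subseteq> verts G"
    and le: "subset_mean p (verts G) (\<lambda>A. real (card (?T A))) \<le> real (card (?T A))"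
    using ex_ge_subset_mean[of "verts G" p "\<lambda>A. real (card (?T A))"] by (auto simp: p_def)
  have "stable_set G (?T A)"
    using A by (intro stable_set_low_degree) (auto intro: finite_subset[OF out_neighbours_subset])
  with * le show ?thesis by (intro exI[of _ "?T A"]) simp
qed

end
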